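(* Consider $L_2$-regularized linear regression in the limit $N\to\infty$, with $[A,\Gamma]=0$. Let $K:=A+\Gamma$ (assumed invertible), $A':=K^{-1}A$, $\Gamma':=K^{-1}\Gamma$, $U:=\mathbf{u}\mathbf{u}^{\mathrm T}$, $\mathbf{w}^*:=K^{-1}A\mathbf{u}$, and suppose the stationary distribution of the SGD parameter has mean $\mathbf{w}^*$ and covariance $\Sigma:=\mathbb{E}_{\mathbf{w}}[(\mathbf{w}-\mathbf{w}^* )(\mathbf{w}-\mathbf{w}^* )^{\mathrm T}]$. Then the averaged noise covariance is $$C=\mathbb{E}_{\mathbf{w}}[C(\mathbf{w})]=\frac1S\left(A\Sigma A+\mathrm{Tr}[A\Sigma]A+\mathrm{Tr}[\Gamma'^{\mathrm T}A\Gamma'U]A+\Gamma A'UA'\Gamma\right).$$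
   Context: Data: $x_i\in\mathbb{R}^D$ i.i.d. $\mathcal N(0,A)$, $A$ symmetric positive definite; noiseless labels $y_i=\mathbf{u}^{\mathrm T}x_i$ for a fixed $\mathbf{u}$. $\Gamma$ is a symmetric $D\times D$ matrix. Per-sample loss $\ell_i(\mathbf{w})=\frac12[(\mathbf{w}-\mathbf{u})^{\mathrm T}x_i]^2+\frac12\mathbf{w}^{\mathrm T}\Gamma\mathbf{w}$, and $L_\Gamma(\mathbf{w})=\frac1N\sum_i\ell_i(\mathbf{w})$. Minibatch size $S$; noise covariance $C(\mathbf{w})=\frac{1}{SN}\sum_i\nabla\ell_i\nabla\ell_i^{\mathrm T}-\frac1S\nabla L_\Gamma\nabla L_\Gamma^{\mathrm T}$, taken in the limit $N\to\infty$; $\mathbb{E}_{\mathbf{w}}$ is over the stationary distribution of SGD. *)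

theory Defs
  imports "HOL-Analysis.Analysis" "HOL-Probability.Probability"
begin

text \<open>Outer product a b^T.\<close>
definition outer :: "real^'n \<Rightarrow> real^'n \<Rightarrow> real^'n^'n" where
  "outer a b = (\<chi> i j. a$i * b$j)"

text \<open>Symmetric positive definite matrices.\<close>
definition pos_def :: "real^'n^'n \<Rightarrow> bool" where
  "pos_def A \<longleftrightarrow> transpose A = A \<and> (\<forall>x. x \<noteq> 0 \<longrightarrow> x \<bullet> (A *v x) > 0)"

text \<open>Density of the centered Gaussian N(0,A) on R^n (A positive definite).\<close>
definition gauss_density :: "real^'n^'n \<Rightarrow> real^'n \<Rightarrow> real" where
  "gauss_density A x =
     exp (- (x \<bullet> (matrix_inv A *v x)) / 2) / sqrt ((2 * pi) ^ CARD('n) * det A)"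

definition gaussian :: "real^'n^'n \<Rightarrow> (real^'n) measure" where
  "gaussian A = density lborel (\<lambda>x. ennreal (gauss_density A x))"

text \<open>Per-sample loss l(w) = 1/2 ((w-u)^T x)^2 + 1/2 w^T Gamma w, and its gradient in w.\<close>
definition sample_loss :: "real^'n^'n \<Rightarrow> real^'n \<Rightarrow> real^'n \<Rightarrow> real^'n \<Rightarrow> real" where
  "sample_loss \<Gamma> u x w = ((w - u) \<bullet> x)^2 / 2 + (w \<bullet> (\<Gamma> *v w)) / 2"

definition sample_grad :: "real^'n^'n \<Rightarrow> real^'n \<Rightarrow> real^'n \<Rightarrow> real^'n \<Rightarrow> real^'n" where
  "sample_grad \<Gamma> u x w = ((w - u) \<bullet> x) *\<^sub>R x + \<Gamma> *v w"

text \<open>Gradient of the full loss L_Gamma in the limit N -> infinity (population average).\<close>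
definition full_grad :: "real^'n^'n \<Rightarrow> real^'n^'n \<Rightarrow> real^'n \<Rightarrow> real^'n \<Rightarrow> real^'n" where
  "full_grad A \<Gamma> u w = integral\<^sup>L (gaussian A) (\<lambda>x. sample_grad \<Gamma> u x w)"

text \<open>SGD noise covariance C(w) in the limit N -> infinity, minibatch size S.\<close>
definition noise_cov :: "real^'n^'n \<Rightarrow> real^'n^'n \<Rightarrow> real^'n \<Rightarrow> nat \<Rightarrow> real^'n \<Rightarrow> real^'n^'n" where
  "noise_cov A \<Gamma> u S w =
     (1 / real S) *\<^sub>R integral\<^sup>L (gaussian A) (\<lambda>x. outer (sample_grad \<Gamma> u x w) (sample_grad \<Gamma> u x w))
     - (1 / real S) *\<^sub>R outer (full_grad A \<Gamma> u w) (full_grad A \<Gamma> u w)"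

lemma sample_grad_is_gradient:
  assumes "transpose \<Gamma> = \<Gamma>"
  shows "((\<lambda>w. sample_loss \<Gamma> u x w) has_derivative (\<lambda>h. sample_grad \<Gamma> u x w \<bullet> h)) (at w)"
proof -
  have sym: "w \<bullet> (\<Gamma> *v h) = (\<Gamma> *v w) \<bullet> h" for h
    by (metis assms dot_lmul_matrix inner_commute vector_transpose_matrix)
  have "((\<lambda>w. ((w - u) \<bullet> x)^2 / 2 + (w \<bullet> (\<Gamma> *v w)) / 2) has_derivative
     (\<lambda>h. (2 * ((w - u) \<bullet> x) * (h \<bullet> x)) / 2 + (h \<bullet> (\<Gamma> *v w) + w \<bullet> (\<Gamma> *v h)) / 2)) (at w)"
    by (auto intro!: derivative_eq_intros bounded_linear.has_derivative[OF matrix_vector_mul_bounded_linear])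
  then show ?thesis
    unfolding sample_loss_def sample_grad_def
    by (rule has_derivative_eq_rhs) (auto simp: fun_eq_iff sym inner_commute algebra_simps field_simps)
qed

end

theory Submission
  imports Defs
begin

text \<open>
  With \<open>v = w - u\<close> the per-sample gradient is \<open>(v \<bullet> x) x + \<Gamma> w\<close>, so the noise
  covariance is a fourth moment of the Gaussian: Isserlis' theorem
  \<open>E[(v \<bullet> x)\<^sup>2 x x\<^sup>T] = (v\<^sup>T A v) A + 2 A v v\<^sup>T A\<close> gives
  \<open>C(w) = (1/S) ((v\<^sup>T A v) A + A v v\<^sup>T A)\<close>, a linear function of \<open>v v\<^sup>T\<close>.
  Averaging over \<open>w\<close> therefore only needs the second moment
  \<open>E[(w - u)(w - u)\<^sup>T] = \<Sigma> + (w\<^sup>* - u)(w\<^sup>* - u)\<^sup>T\<close>, and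
  \<open>w\<^sup>* - u = - \<Gamma>' u\<close> because \<open>K\<^sup>-\<^sup>1 (A + \<Gamma>) = I\<close>; commutativity of \<open>A\<close> and \<open>\<Gamma>\<close>
  turns the resulting terms into the ones of the statement.
  The Gaussian moments come from writing \<open>A = C C\<^sup>T\<close> with \<open>C\<^sup>T c\<close> on a coordinate axis:
  the linear change of variables \<open>x = C z\<close> makes \<open>c \<bullet> x\<close> a scaled standard normal
  coordinate.
\<close>

section \<open>Linear change of variables for Lebesgue measure\<close>

lemma density_const_inverse:
  assumes "N = density M (\<lambda>_. ennreal k)" and "0 < k"
  shows "M = density N (\<lambda>_. ennreal (1 / k))"
  using assms by (simp add: density_density_eq ennreal_mult'[symmetric] density_1)

lemma linear_borel_measurable_cart:
  fixes f :: "real^'n \<Rightarrow> real^'m"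
  shows "linear f \<Longrightarrow> f \<in> borel_measurable borel"
  by (intro borel_measurable_continuous_onI linear_continuous_on linear_conv_bounded_linear[THEN iffD1])

lemma Basis_vec_axis: "(Basis :: (real^'n) set) = range (\<lambda>i. axis i 1)"
  by (auto simp: Basis_vec_def)

lemma det_matrix_zero_component:
  fixes f :: "real^'n \<Rightarrow> real^'n"
  assumes "\<And>x. f x $ i = 0"
  shows "det (matrix f) = 0"
  by (rule det_zero_row(1)[of i]) (simp add: matrix_def row_def assms vec_eq_iff)

lemma distr_lborel_stretch:
  fixes c :: "'n::finite \<Rightarrow> real"
  assumes "\<And>i. c i \<noteq> 0"
  shows "distr lborel borel (\<lambda>x::real^'n. \<chi> i. c i * x $ i) = density lborel (\<lambda>_. ennreal (1 / \<bar>prod c UNIV\<bar>))"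
proof (rule density_const_inverse)
  define c' where "c' b = (\<chi> i. c i) \<bullet> b" for b :: "real^'n"
  have "(\<Sum>b\<in>Basis. (c' b * (x \<bullet> b)) *\<^sub>R b) = (\<Sum>i\<in>UNIV. (c i * x $ i) *\<^sub>R axis i 1)" for x :: "real^'n"
    by (simp add: Basis_vec_axis sum.reindex inj_on_def axis_eq_axis c'_def inner_axis)
  then have "(\<lambda>x::real^'n. \<chi> i. c i * x $ i) = (\<lambda>x. 0 + (\<Sum>b\<in>Basis. (c' b * (x \<bullet> b)) *\<^sub>R b))"
    by (auto simp: fun_eq_iff vec_eq_iff axis_def if_distrib sum.delta cong: if_cong)
  moreover have "(\<Prod>b\<in>Basis. \<bar>c' b\<bar>) = \<bar>prod c UNIV\<bar>"
    by (simp add: c'_def Basis_vec_axis prod.reindex inj_on_def axis_eq_axis inner_axis abs_prod)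
  moreover have "c' b \<noteq> 0" if "b \<in> Basis" for b
    using that assms by (auto simp: c'_def Basis_vec_axis inner_axis)
  ultimately show "lborel = density (distr lborel borel (\<lambda>x::real^'n. \<chi> i. c i * x $ i)) (\<lambda>_. ennreal \<bar>prod c UNIV\<bar>)"
    using lborel_affine_euclidean[of c' 0] by simp
  show "0 < \<bar>prod c UNIV\<bar>"
    using assms by simp
qed

lemma prod_Basis_cart: "(\<Prod>b\<in>(Basis :: (real^'n) set). g (v \<bullet> b)) = (\<Prod>i\<in>UNIV. g (v $ i))"
  by (simp add: Basis_vec_axis prod.reindex inj_on_def axis_eq_axis inner_axis)

lemma emeasure_lborel_box_cart:
  fixes l u :: "real^'n"
  assumes "\<And>i. l $ i \<le> u $ i"
  shows "emeasure lborel (box l u) = (\<Prod>i\<in>UNIV. u $ i - l $ i)"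
proof -
  have "\<forall>b\<in>Basis. l \<bullet> b \<le> u \<bullet> b"
    using assms by (auto simp: Basis_vec_axis inner_axis)
  then show ?thesis
    by (simp add: emeasure_lborel_box_eq prod_Basis_cart[where g="\<lambda>t. t"])
qed

lemma distr_lborel_swap_coordinates:
  "distr lborel borel (\<lambda>x::real^'n. \<chi> i. x $ Transposition.transpose m n i) = lborel"
proof (rule lborel_eqI[symmetric])
  let ?f = "\<lambda>x::real^'n. \<chi> i. x $ Transposition.transpose m n i"
  have [measurable]: "?f \<in> borel_measurable borel"
    by (rule linear_borel_measurable_cart) (simp add: linear_iff vec_eq_iff)
  fix l u :: "real^'n"
  assume lu: "\<And>b. b \<in> Basis \<Longrightarrow> l \<bullet> b \<le> u \<bullet> b"
  have le: "l $ i \<le> u $ i" for i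
    using lu[of "axis i 1"] by (simp add: inner_axis)
  have "(\<forall>i. l $ i < x $ Transposition.transpose m n i \<and> x $ Transposition.transpose m n i < u $ i)
    \<longleftrightarrow> (\<forall>i. l $ Transposition.transpose m n i < x $ i \<and> x $ i < u $ Transposition.transpose m n i)" for x :: "real^'n"
    by (metis transpose_involutory)
  then have "?f -` box l u = box (?f l) (?f u)"
    by (simp add: mem_box_cart set_eq_iff)
  then have "emeasure (distr lborel borel ?f) (box l u) = (\<Prod>i\<in>UNIV. u $ Transposition.transpose m n i - l $ Transposition.transpose m n i)"
    using le by (simp add: emeasure_distr emeasure_lborel_box_cart)
  also have "\<dots> = (\<Prod>i\<in>UNIV. u $ i - l $ i)"
    using prod.permute[OF permutes_swap_id[of m UNIV n], of "\<lambda>i. u $ i - l $ i"] by (simp add: o_def)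
  finally show "emeasure (distr lborel borel ?f) (box l u) = (\<Prod>b\<in>Basis. (u - l) \<bullet> b)"
    by (simp add: prod_Basis_cart[where g="\<lambda>t. t"])
qed simp

lemma measure_shear_cbox:
  fixes m n :: "'n::finite"
  assumes "m \<noteq> n"
  shows "measure lebesgue ((\<lambda>x::real^'n. \<chi> i. if i = m then x $ m + x $ n else x $ i) ` cbox a b)
    = measure lebesgue (cbox a b)"
proof (cases "cbox a b = {}")
  case False
  let ?f = "\<lambda>x::real^'n. \<chi> i. if i = m then x $ m + x $ n else x $ i"
  have "linear ?f"
    by (simp add: linear_iff vec_eq_iff algebra_simps)
  \<comment> \<open>translate so that the side condition \<open>0 \<le> a $ n\<close> of \<open>measure_shear_interval\<close> holds\<close>
  define v :: "real^'n" where "v = axis n (a $ n)"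
  have translate: "cbox a b = (+) v ` cbox (a - v) (b - v)"
    using cbox_translation[of v "a - v" "b - v"] by simp
  then have "?f ` cbox a b = (+) (?f v) ` ?f ` cbox (a - v) (b - v)"
    by (simp add: image_image linear_add[OF \<open>linear ?f\<close>])
  then have "measure lebesgue (?f ` cbox a b) = measure lebesgue (?f ` cbox (a - v) (b - v))"
    by (simp add: measure_translation)
  also have "\<dots> = measure lebesgue (cbox (a - v) (b - v))"
    using False assms by (intro measure_shear_interval) (auto simp: v_def box_ne_empty inner_diff_left)
  also have "\<dots> = measure lebesgue (cbox a b)"
    using translate by (simp add: measure_translation)
  finally show ?thesis .
qed simp

lemma distr_lborel_shear:
  fixes m n :: "'n::finite"
  assumes "m \<noteq> n"
  shows "distr lborel borel (\<lambda>x::real^'n. \<chi> i. if i = m then x $ m + x $ n else x $ i) = lborel"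
proof -
  let ?f = "\<lambda>x::real^'n. \<chi> i. if i = m then x $ m + x $ n else x $ i"
  let ?g = "\<lambda>x::real^'n. \<chi> i. if i = m then x $ m - x $ n else x $ i"
  have lin: "linear ?f" "linear ?g"
    by (simp_all add: linear_iff vec_eq_iff algebra_simps)
  note [measurable] = linear_borel_measurable_cart[OF lin(1)] linear_borel_measurable_cart[OF lin(2)]
  have fg: "?f (?g x) = x" "?g (?f x) = x" for x
    using assms by (simp_all add: vec_eq_iff)
  \<comment> \<open>\<open>measure_shear_cbox\<close> measures images under \<open>?f\<close>, i.e. preimages under its inverse \<open>?g\<close>.\<close>
  have "distr lborel borel ?g = lborel"
  proof (rule lborel_eqI[symmetric])
    fix l u :: "real^'n"
    assume lu: "\<And>b. b \<in> Basis \<Longrightarrow> l \<bullet> b \<le> u \<bullet> b"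
    have pre: "?g -` box l u = ?f ` box l u"
      by (auto simp: fg intro: image_eqI[where x="?g _"])
    have "?f ` box l u \<in> lmeasurable \<and> 1 * measure lebesgue (box l u) = measure lebesgue (?f ` box l u)"
      using assms by (intro measure_linear_sufficient[OF lin(1)]) (simp_all add: measure_shear_cbox)
    moreover have "?f ` box l u \<in> sets borel"
      using measurable_sets_borel[of ?g borel "box l u"] by (simp add: pre)
    ultimately have "emeasure lebesgue (?f ` box l u) = emeasure lebesgue (box l u)"
      by (simp add: emeasure_eq_measure2)
    with \<open>?f ` box l u \<in> sets borel\<close> have "emeasure lborel (?g -` box l u) = emeasure lborel (box l u)"
      by (simp add: pre emeasure_completion)
    then show "emeasure (distr lborel borel ?g) (box l u) = (\<Prod>b\<in>Basis. (u - l) \<bullet> b)"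
      using lu by (simp add: emeasure_distr)
  qed simp
  then have "distr lborel borel ?f = distr (distr lborel borel ?g) borel ?f"
    by simp
  also have "\<dots> = lborel"
    by (simp add: distr_distr o_def fg distr_id2)
  finally show ?thesis .
qed

lemma det_matrix_stretch: "det (matrix (\<lambda>x::real^'n. \<chi> i. c i * x $ i)) = prod c UNIV"
  by (simp add: det_diagonal matrix_def axis_def)

lemma abs_det_matrix_swap_coordinates:
  assumes "m \<noteq> n"
  shows "\<bar>det (matrix (\<lambda>x::real^'n. \<chi> i. x $ Transposition.transpose m n i))\<bar> = 1"
proof -
  have "matrix (\<lambda>x::real^'n. \<chi> i. x $ Transposition.transpose m n i) = (\<chi> i. mat 1 $ Transposition.transpose m n i)"
    by (simp add: matrix_def vec_eq_iff mat_def axis_def)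
  then show ?thesis
    using assms by (simp add: det_permute_rows permutes_swap_id sign_swap_id)
qed

lemma det_matrix_shear:
  assumes "m \<noteq> n"
  shows "det (matrix (\<lambda>x::real^'n. \<chi> i. if i = m then x $ m + x $ n else x $ i)) = 1"
proof -
  have "matrix (\<lambda>x::real^'n. \<chi> i. if i = m then x $ m + x $ n else x $ i)
      = (\<chi> k. if k = m then row m (mat 1) + 1 *s row n (mat 1) else row k (mat 1))"
    by (auto simp: matrix_def vec_eq_iff row_def axis_def mat_def)
  then show ?thesis
    using det_row_operation[OF assms, of "mat 1" 1] by simp
qed

(* Change_Of_Vars proves the corresponding measure_linear_image only for index types of
   class wellorder; the index type here is an arbitrary finite type. *)
theorem distr_lborel_linear:
  fixes f :: "real^'n \<Rightarrow> real^'n"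
  assumes "linear f" and "det (matrix f) \<noteq> 0"
  shows "distr lborel borel f = density lborel (\<lambda>_. ennreal (1 / \<bar>det (matrix f)\<bar>))"
proof -
  define law :: "(real^'n \<Rightarrow> real^'n) \<Rightarrow> (real^'n) measure"
    where "law f = density lborel (\<lambda>_. ennreal (1 / \<bar>det (matrix f)\<bar>))" for f
  have "det (matrix f) \<noteq> 0 \<longrightarrow> distr lborel borel f = law f"
  proof (rule induct_linear_elementary[OF \<open>linear f\<close>]; intro impI)
    fix f g :: "real^'n \<Rightarrow> real^'n"
    assume lin: "linear f" "linear g" and det: "det (matrix (f \<circ> g)) \<noteq> 0"
      and IH: "det (matrix f) \<noteq> 0 \<longrightarrow> distr lborel borel f = law f"
        "det (matrix g) \<noteq> 0 \<longrightarrow> distr lborel borel g = law g"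
    note [measurable] = linear_borel_measurable_cart[OF lin(1)] linear_borel_measurable_cart[OF lin(2)]
    have dets: "det (matrix (f \<circ> g)) = det (matrix f) * det (matrix g)"
      by (simp add: matrix_compose[OF lin(2) lin(1)] det_mul)
    with det IH have df: "distr lborel borel f = law f" and dg: "distr lborel borel g = law g"
      by auto
    have "distr lborel borel (f \<circ> g) = distr (law g) borel f"
      by (simp add: distr_distr dg[symmetric])
    also have "\<dots> = density (law f) (\<lambda>_. ennreal (1 / \<bar>det (matrix g)\<bar>))"
      unfolding law_def[of g] df[symmetric] by (simp add: density_distr)
    also have "\<dots> = law (f \<circ> g)"
      by (simp add: law_def density_density_eq dets abs_mult ennreal_mult[symmetric])
    finally show "distr lborel borel (f \<circ> g) = law (f \<circ> g)" .
  next
    fix f :: "real^'n \<Rightarrow> real^'n" and i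
    assume "\<And>x. f x $ i = 0" and "det (matrix f) \<noteq> 0"
    then show "distr lborel borel f = law f"
      using det_matrix_zero_component by blast
  next
    fix c :: "'n \<Rightarrow> real"
    assume "det (matrix (\<lambda>x::real^'n. \<chi> i. c i * x $ i)) \<noteq> 0"
    then show "distr lborel borel (\<lambda>x::real^'n. \<chi> i. c i * x $ i) = law (\<lambda>x. \<chi> i. c i * x $ i)"
      by (simp add: det_matrix_stretch distr_lborel_stretch law_def)
  next
    fix m n :: 'n
    assume "m \<noteq> n"
    then show "distr lborel borel (\<lambda>x::real^'n. \<chi> i. x $ Transposition.transpose m n i)
        = law (\<lambda>x. \<chi> i. x $ Transposition.transpose m n i)"
      by (simp add: abs_det_matrix_swap_coordinates distr_lborel_swap_coordinates density_1 law_def)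
  next
    fix m n :: 'n
    assume "m \<noteq> n"
    then show "distr lborel borel (\<lambda>x::real^'n. \<chi> i. if i = m then x $ m + x $ n else x $ i)
        = law (\<lambda>x. \<chi> i. if i = m then x $ m + x $ n else x $ i)"
      by (simp add: det_matrix_shear distr_lborel_shear density_1 law_def)
  qed
  with assms show ?thesis
    by (simp add: law_def)
qed

lemma
  fixes B :: "real^'n^'n" and f :: "real^'n \<Rightarrow> 'a::{banach, second_countable_topology}"
  assumes B: "invertible B" and [measurable]: "f \<in> borel_measurable borel"
  shows integrable_lborel_matrix_vector_mult_iff: "integrable lborel (\<lambda>z. f (B *v z)) \<longleftrightarrow> integrable lborel f"
    and integral_lborel_matrix_vector_mult: "(\<integral>z. f (B *v z) \<partial>lborel) = (1 / \<bar>det B\<bar>) *\<^sub>R (\<integral>x. f x \<partial>lborel)"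
proof -
  have [measurable]: "(*v) B \<in> borel_measurable borel"
    by (simp add: linear_borel_measurable_cart)
  have det: "det B \<noteq> 0"
    using B by (simp add: invertible_det_nz)
  have D: "distr lborel borel ((*v) B) = density lborel (\<lambda>_. ennreal (1 / \<bar>det B\<bar>))"
    using distr_lborel_linear[of "(*v) B"] det by simp
  have "integrable lborel (\<lambda>z. f (B *v z)) \<longleftrightarrow> integrable (distr lborel borel ((*v) B)) f"
    by (simp add: integrable_distr_eq)
  also have "\<dots> \<longleftrightarrow> integrable lborel (\<lambda>x. (1 / \<bar>det B\<bar>) *\<^sub>R f x)"
    unfolding D by (subst integrable_density) auto
  also have "\<dots> \<longleftrightarrow> integrable lborel f"
    using det integrable_scaleR_right[of "\<bar>det B\<bar>" lborel "\<lambda>x. (1 / \<bar>det B\<bar>) *\<^sub>R f x"] by auto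
  finally show "integrable lborel (\<lambda>z. f (B *v z)) \<longleftrightarrow> integrable lborel f" .
  show "(\<integral>z. f (B *v z) \<partial>lborel) = (1 / \<bar>det B\<bar>) *\<^sub>R (\<integral>x. f x \<partial>lborel)"
  proof -
    have "(\<integral>z. f (B *v z) \<partial>lborel) = (\<integral>x. f x \<partial>distr lborel borel ((*v) B))"
      by (simp add: integral_distr)
    also have "\<dots> = (\<integral>x. (1 / \<bar>det B\<bar>) *\<^sub>R f x \<partial>lborel)"
      unfolding D by (subst integral_density) auto
    finally show ?thesis
      by simp
  qed
qed

section \<open>Factorization of positive definite matrices\<close>

lemma outer_mult_outer: "outer a b ** outer c d = (b \<bullet> c) *\<^sub>R outer a d"
  by (simp add: vec_eq_iff matrix_matrix_mult_def outer_def inner_vec_def sum_distrib_left sum_distrib_right algebra_simps)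

lemma inner_matrix_vector_mult_transpose: "x \<bullet> (T *v y) = (transpose T *v x) \<bullet> y"
  for T :: "real^'n^'m"
  by (simp add: dot_lmul_matrix[symmetric])

lemma pos_def_congruence:
  fixes M T :: "real^'n^'n"
  assumes "pos_def M" and "invertible T"
  shows "pos_def (transpose T ** M ** T)"
  unfolding pos_def_def
proof safe
  show "transpose (transpose T ** M ** T) = transpose T ** M ** T"
    using assms(1) by (simp add: pos_def_def matrix_transpose_mul matrix_mul_assoc)
  fix x :: "real^'n"
  assume "x \<noteq> 0"
  then have "T *v x \<noteq> 0"
    using assms(2) by (metis invertible_left_inverse matrix_vector_mul_assoc matrix_vector_mul_lid matrix_vector_mult_0_right)
  then have "0 < (T *v x) \<bullet> (M *v (T *v x))"
    using assms(1) by (simp add: pos_def_def)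
  also have "\<dots> = x \<bullet> ((transpose T ** M ** T) *v x)"
    by (simp add: inner_matrix_vector_mult_transpose matrix_vector_mul_assoc[symmetric] del: transpose_matrix_vector)
  finally show "0 < x \<bullet> ((transpose T ** M ** T) *v x)" .
qed

lemma pos_def_diagonal_pos:
  fixes M :: "real^'n^'n"
  assumes "pos_def M"
  shows "0 < M $ k $ k"
proof -
  have "0 < axis k 1 \<bullet> (M *v axis k 1)"
    using assms by (simp add: pos_def_def axis_eq_0_iff)
  then show ?thesis
    by (simp add: inner_axis' matrix_vector_mul_component inner_axis)
qed

lemma matrix_diff_ldistrib: "(A::'a::ring_1^'n^'m) ** (B - C) = A ** B - A ** C"
  by (vector matrix_matrix_mult_def sum_subtractf[symmetric] algebra_simps)

lemma matrix_diff_rdistrib: "((B::'a::ring_1^'n^'m) - C) ** A = B ** A - C ** A"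
  by (vector matrix_matrix_mult_def sum_subtractf[symmetric] algebra_simps)

lemma matrix_add_rdistrib: "((B::'a::semiring_1^'n^'m) + C) ** A = B ** A + C ** A"
  by (vector matrix_matrix_mult_def sum.distrib[symmetric] algebra_simps)

lemma outer_axis_mult_entry: "(outer a (axis k 1) ** M) $ i $ j = a $ i * M $ k $ j"
  for M :: "real^'n^'n"
  by (simp add: matrix_matrix_mult_def outer_def axis_def if_distrib[of "\<lambda>x. _ * x * _"] cong: if_cong)

lemma mult_outer_axis_entry: "(M ** outer (axis k 1) b) $ i $ j = M $ i $ k * b $ j"
  for M :: "real^'n^'n"
  by (simp add: matrix_matrix_mult_def outer_def axis_def if_distrib[of "\<lambda>x. _ * (x * _)"] cong: if_cong)

lemma congruence_by_shear:
  fixes M :: "real^'n^'n"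
  shows "(transpose (mat 1 - outer (axis k 1) r) ** M ** (mat 1 - outer (axis k 1) r)) $ i $ j
    = M $ i $ j - r $ i * M $ k $ j - M $ i $ k * r $ j + r $ i * M $ k $ k * r $ j"
proof -
  have "transpose (mat 1 - outer (axis k 1) r) = mat 1 - outer r (axis k 1)"
    by (simp add: vec_eq_iff transpose_def outer_def mat_def)
  then show ?thesis
    by (simp add: matrix_diff_ldistrib matrix_diff_rdistrib outer_axis_mult_entry mult_outer_axis_entry
        matrix_mul_assoc[symmetric])
qed

lemma shear_mult_inverse:
  fixes r :: "real^'n"
  assumes "r $ k = 0"
  shows "(mat 1 - outer (axis k 1) r) ** (mat 1 + outer (axis k 1) r) = mat 1"
    and "(mat 1 + outer (axis k 1) r) ** (mat 1 - outer (axis k 1) r) = mat 1"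
proof -
  have "outer (axis k 1) r ** outer (axis k 1) r = 0"
    using assms by (simp add: outer_mult_outer inner_axis)
  then show "(mat 1 - outer (axis k 1) r) ** (mat 1 + outer (axis k 1) r) = mat 1"
    and "(mat 1 + outer (axis k 1) r) ** (mat 1 - outer (axis k 1) r) = mat 1"
    by (simp_all add: matrix_diff_rdistrib matrix_add_ldistrib matrix_diff_ldistrib matrix_add_rdistrib)
qed

lemma pos_def_symmetric: "pos_def M \<Longrightarrow> M $ i $ j = M $ j $ i"
  for M :: "real^'n^'n"
  unfolding pos_def_def by (metis transpose_def vec_lambda_beta)

lemma diagonal_pos_factorization:
  fixes M :: "real^'n^'n"
  assumes diag: "\<And>i j. i \<noteq> j \<Longrightarrow> M $ i $ j = 0" and pos: "\<And>i. 0 < M $ i $ i"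
  shows "\<exists>P::real^'n^'n. invertible P \<and> M = P ** transpose P"
proof -
  define P :: "real^'n^'n" where "P = (\<chi> i j. if i = j then sqrt (M $ i $ i) else 0)"
  have "det P = (\<Prod>i\<in>UNIV. sqrt (M $ i $ i))"
    by (simp add: P_def det_diagonal)
  then have "invertible P"
    using pos by (simp add: invertible_det_nz less_imp_neq[symmetric])
  moreover have "M = P ** transpose P"
    using diag pos by (auto simp: P_def vec_eq_iff matrix_matrix_mult_def transpose_def
        if_distrib[of "\<lambda>x. x * _"] less_imp_le cong: if_cong)
  ultimately show ?thesis
    by blast
qed

lemma pos_def_factorization_off_support:
  fixes M :: "real^'n^'n" and K :: "'n set"
  assumes "finite K" and "pos_def M" and "\<And>i j. i \<noteq> j \<Longrightarrow> i \<notin> K \<or> j \<notin> K \<Longrightarrow> M $ i $ j = 0"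
  shows "\<exists>P::real^'n^'n. invertible P \<and> M = P ** transpose P"
  using assms
proof (induction K arbitrary: M rule: finite_induct)
  case empty
  then show ?case
    by (intro diagonal_pos_factorization) (auto intro: pos_def_diagonal_pos)
next
  case (insert k K M)
  \<comment> \<open>symmetric Gaussian elimination: the shear \<open>T\<close> clears row and column \<open>k\<close> off the diagonal\<close>
  define d where "d = M $ k $ k"
  have "0 < d"
    unfolding d_def using insert.prems(1) by (rule pos_def_diagonal_pos)
  define r :: "real^'n" where "r = (\<chi> j. if j = k then 0 else M $ k $ j / d)"
  define T where "T = mat 1 - outer (axis k 1) r"
  define S where "S = mat 1 + outer (axis k 1) r"
  have "T ** S = mat 1" "S ** T = mat 1"
    unfolding T_def S_def by (simp_all add: shear_mult_inverse r_def)
  then have "invertible T" "invertible S"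
    by (auto simp: invertible_def)
  define M' where "M' = transpose T ** M ** T"
  have "pos_def M'"
    unfolding M'_def using insert.prems(1) \<open>invertible T\<close> by (rule pos_def_congruence)
  have M'_zero: "M' $ i $ j = 0" if "i \<noteq> j" "i \<notin> K \<or> j \<notin> K" for i j
  proof -
    have M': "M' $ a $ b = M $ a $ b - r $ a * M $ k $ b - M $ a $ k * r $ b + r $ a * d * r $ b" for a b
      unfolding M'_def T_def d_def by (rule congruence_by_shear)
    have sym: "M $ a $ b = M $ b $ a" for a b
      using insert.prems(1) by (rule pos_def_symmetric)
    show ?thesis
      using that insert.prems(2)[of i j] insert.prems(2)[of k j] insert.prems(2)[of i k] \<open>0 < d\<close>
      by (cases "i = k"; cases "j = k") (auto simp: M' r_def d_def sym[of i k])
  qed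
  obtain P' :: "real^'n^'n" where "invertible P'" "M' = P' ** transpose P'"
    using insert.IH[OF \<open>pos_def M'\<close> M'_zero] by blast
  have "M = transpose (T ** S) ** M ** (T ** S)"
    using \<open>T ** S = mat 1\<close> by simp
  also have "\<dots> = transpose S ** M' ** S"
    by (simp add: M'_def matrix_transpose_mul matrix_mul_assoc)
  also have "\<dots> = (transpose S ** P') ** transpose (transpose S ** P')"
    by (simp add: \<open>M' = P' ** transpose P'\<close> matrix_transpose_mul matrix_mul_assoc)
  finally show ?case
    using \<open>invertible P'\<close> \<open>invertible S\<close> by (metis invertible_mult transpose_invertible)
qed

lemma pos_def_factorization:
  fixes A :: "real^'n^'n"
  assumes "pos_def A"
  obtains P :: "real^'n^'n" where "invertible P" "A = P ** transpose P"
proof -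
  have "\<exists>P::real^'n^'n. invertible P \<and> A = P ** transpose P"
    using assms by (intro pos_def_factorization_off_support[of UNIV]) simp_all
  with that show thesis
    by blast
qed

lemma
  fixes A :: "real^'n^'n"
  assumes "invertible A"
  shows matrix_inv_right: "A ** matrix_inv A = mat 1"
    and matrix_inv_left: "matrix_inv A ** A = mat 1"
  using someI_ex[OF assms[unfolded invertible_def]] by (simp_all add: matrix_inv_def)

lemma matrix_inv_unique:
  fixes A B :: "real^'n^'n"
  assumes "A ** B = mat 1"
  shows "matrix_inv A = B"
proof -
  have "invertible A"
    using assms invertible_right_inverse by blast
  then have "matrix_inv A = matrix_inv A ** (A ** B)"
    by (simp add: assms)
  also have "\<dots> = B"
    using \<open>invertible A\<close> by (simp add: matrix_mul_assoc matrix_inv_left)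
  finally show ?thesis .
qed

lemma pos_def_det_pos:
  fixes A :: "real^'n^'n"
  assumes "pos_def A"
  shows "0 < det A"
proof -
  obtain P :: "real^'n^'n" where "invertible P" "A = P ** transpose P"
    using pos_def_factorization[OF assms] by blast
  then have "det P \<noteq> 0" "det A = det P * det P"
    by (simp_all add: det_mul det_transpose invertible_det_nz)
  then show ?thesis
    by (metis not_real_square_gt_zero)
qed

section \<open>Moments of the centred Gaussian\<close>

lemma prod_std_normal_density_cart:
  "(\<Prod>i\<in>UNIV. std_normal_density (z $ i)) = exp (- (z \<bullet> z) / 2) / sqrt ((2 * pi) ^ CARD('n))"
  for z :: "real^'n"
proof -
  have "(\<Prod>i\<in>UNIV. std_normal_density (z $ i)) = (\<Prod>i\<in>UNIV. (1 / sqrt (2 * pi)) * exp (- (z $ i)\<^sup>2 / 2))"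
    by (simp add: std_normal_density_def)
  also have "\<dots> = (1 / sqrt (2 * pi)) ^ CARD('n) * exp (\<Sum>i\<in>UNIV. - (z $ i)\<^sup>2 / 2)"
    by (subst prod.distrib) (simp add: exp_sum)
  also have "(\<Sum>i\<in>UNIV. - (z $ i)\<^sup>2 / 2) = - (z \<bullet> z) / 2"
    by (simp add: inner_vec_def sum_divide_distrib[symmetric] sum_negf power2_eq_square)
  finally show ?thesis
    by (simp add: real_sqrt_power[symmetric] power_one_over power_mult_distrib)
qed

lemma gauss_density_standardize:
  fixes C :: "real^'n^'n"
  assumes "invertible C"
  shows "gauss_density (C ** transpose C) (C *v z) * \<bar>det C\<bar> = (\<Prod>i\<in>UNIV. std_normal_density (z $ i))"
proof -
  define Ci where "Ci = matrix_inv C"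
  have "(C ** transpose C) ** (transpose Ci ** Ci) = C ** transpose (Ci ** C) ** Ci"
    by (simp add: matrix_mul_assoc matrix_transpose_mul)
  also have "\<dots> = mat 1"
    using assms by (simp add: Ci_def matrix_inv_left matrix_inv_right)
  finally have "(C ** transpose C) ** (transpose Ci ** Ci) = mat 1" .
  then have "matrix_inv (C ** transpose C) = transpose Ci ** Ci"
    by (rule matrix_inv_unique)
  moreover have "Ci *v (C *v z) = z"
    using assms by (simp add: matrix_vector_mul_assoc Ci_def matrix_inv_left)
  ultimately have "(C *v z) \<bullet> (matrix_inv (C ** transpose C) *v (C *v z)) = z \<bullet> z"
    by (simp add: matrix_vector_mul_assoc[symmetric] inner_matrix_vector_mult_transpose
        del: transpose_matrix_vector)
  moreover have "sqrt ((2 * pi) ^ CARD('n) * det (C ** transpose C)) = sqrt ((2 * pi) ^ CARD('n)) * \<bar>det C\<bar>"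
    by (simp add: det_mul det_transpose real_sqrt_mult)
  moreover have "det C \<noteq> 0"
    using assms by (simp add: invertible_det_nz)
  ultimately show ?thesis
    by (simp add: gauss_density_def prod_std_normal_density_cart)
qed

lemma orthogonal_matrix_align:
  fixes v :: "real^'n"
  obtains Q :: "real^'n^'n" where "orthogonal_matrix Q" "transpose Q *v v = norm v *\<^sub>R axis k 1"
proof (cases "v = 0")
  case True
  then show ?thesis
    using that[of "mat 1"] by (simp add: orthogonal_matrix_id)
next
  case False
  obtain Q :: "real^'n^'n" where "orthogonal_matrix Q" "Q *v axis k 1 = v /\<^sub>R norm v"
    using orthogonal_matrix_exists_basis[of "v /\<^sub>R norm v"] False by auto
  moreover from this have "transpose Q *v v = norm v *\<^sub>R axis k 1"
    using False by (metis matrix_vector_mul_assoc matrix_vector_mul_lid matrix_vector_mult_scaleR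
        orthogonal_matrix_def scaleR_right.zero divideR_right norm_eq_zero)
  ultimately show ?thesis
    using that by blast
qed

lemma gaussian_standardization:
  fixes A :: "real^'n^'n" and c :: "real^'n"
  assumes "pos_def A"
  obtains C :: "real^'n^'n" where "invertible C" "C ** transpose C = A"
    "transpose C *v c = sqrt (c \<bullet> (A *v c)) *\<^sub>R axis i0 1"
proof -
  obtain P :: "real^'n^'n" where P: "invertible P" "A = P ** transpose P"
    using pos_def_factorization[OF assms] by blast
  define v where "v = transpose P *v c"
  have "c \<bullet> (A *v c) = v \<bullet> v"
    by (simp add: P(2) v_def inner_matrix_vector_mult_transpose matrix_vector_mul_assoc[symmetric]
        del: transpose_matrix_vector)
  then have norm_v: "sqrt (c \<bullet> (A *v c)) = norm v"
    by (simp add: norm_eq_sqrt_inner)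
  obtain Q :: "real^'n^'n" where Q: "orthogonal_matrix Q" "transpose Q *v v = norm v *\<^sub>R axis i0 1"
    by (rule orthogonal_matrix_align)
  show ?thesis
  proof
    have "invertible Q"
      using Q(1) unfolding orthogonal_matrix_def invertible_def by blast
    with P(1) show "invertible (P ** Q)"
      by (rule invertible_mult)
    show "(P ** Q) ** transpose (P ** Q) = A"
    proof -
      have "(P ** Q) ** transpose (P ** Q) = P ** (Q ** transpose Q) ** transpose P"
        by (simp add: matrix_transpose_mul matrix_mul_assoc)
      then show ?thesis
        using Q(1) by (simp add: P(2) orthogonal_matrix_def)
    qed
    show "transpose (P ** Q) *v c = sqrt (c \<bullet> (A *v c)) *\<^sub>R axis i0 1"
      by (simp add: matrix_transpose_mul matrix_vector_mul_assoc[symmetric] Q(2)[unfolded v_def] norm_v v_def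
          del: transpose_matrix_vector)
  qed
qed

lemma
  fixes g :: "'a::euclidean_space \<Rightarrow> real \<Rightarrow> real"
  assumes g: "\<And>b. b \<in> Basis \<Longrightarrow> integrable lborel (g b)"
  shows integrable_lborel_prod_Basis: "integrable lborel (\<lambda>z::'a. \<Prod>b\<in>Basis. g b (z \<bullet> b))"
    and integral_lborel_prod_Basis:
      "(\<integral>z. (\<Prod>b\<in>Basis. g b (z \<bullet> b)) \<partial>lborel) = (\<Prod>b\<in>Basis. \<integral>t. g b t \<partial>lborel)"
proof -
  interpret product_sigma_finite "\<lambda>_::'a. lborel :: real measure"
    by standard
  define emb :: "('a \<Rightarrow> real) \<Rightarrow> 'a" where "emb f = (\<Sum>b\<in>Basis. f b *\<^sub>R b)" for f
  have [measurable]: "emb \<in> borel_measurable (\<Pi>\<^sub>M b\<in>Basis. lborel)"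
    unfolding emb_def by measurable
  have lborel: "lborel = distr (\<Pi>\<^sub>M b\<in>Basis. lborel) borel emb"
    unfolding emb_def by (rule lborel_eq)
  have emb_inner: "emb f \<bullet> b = f b" if "b \<in> Basis" for f b
    using that by (simp add: emb_def inner_sum_left inner_Basis if_distrib sum.delta cong: if_cong)
  have [measurable]: "(\<lambda>z::'a. \<Prod>b\<in>Basis. g b (z \<bullet> b)) \<in> borel_measurable borel"
  proof (intro borel_measurable_prod)
    fix b :: 'a
    assume "b \<in> Basis"
    have [measurable]: "g b \<in> borel_measurable borel"
      using borel_measurable_integrable[OF g[OF \<open>b \<in> Basis\<close>]] by simp
    show "(\<lambda>z::'a. g b (z \<bullet> b)) \<in> borel_measurable borel"
      by measurable
  qed
  have integrable_prod: "integrable (\<Pi>\<^sub>M b\<in>Basis. lborel) (\<lambda>f. \<Prod>b\<in>Basis. g b (f b))"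
    by (rule product_integrable_prod) (simp_all add: g)
  then show "integrable lborel (\<lambda>z::'a. \<Prod>b\<in>Basis. g b (z \<bullet> b))"
    by (subst lborel, subst integrable_distr_eq) (auto simp: emb_inner cong: prod.cong)
  have "(\<integral>z. (\<Prod>b\<in>Basis. g b (z \<bullet> b)) \<partial>lborel) = (\<integral>f. (\<Prod>b\<in>Basis. g b (f b)) \<partial>(\<Pi>\<^sub>M b\<in>Basis. lborel))"
    by (subst lborel, subst integral_distr) (auto simp: emb_inner cong: prod.cong)
  also have "\<dots> = (\<Prod>b\<in>Basis. \<integral>t. g b t \<partial>lborel)"
    by (rule product_integral_prod) (simp_all add: g)
  finally show "(\<integral>z. (\<Prod>b\<in>Basis. g b (z \<bullet> b)) \<partial>lborel) = (\<Prod>b\<in>Basis. \<integral>t. g b t \<partial>lborel)" .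
qed

lemma
  fixes h :: "real \<Rightarrow> real" and b0 :: "'a::euclidean_space"
  assumes b0: "b0 \<in> Basis" and h: "integrable lborel (\<lambda>t. std_normal_density t * h t)"
  shows integrable_lborel_std_normal_prod:
      "integrable lborel (\<lambda>z::'a. (\<Prod>b\<in>Basis. std_normal_density (z \<bullet> b)) * h (z \<bullet> b0))"
    and integral_lborel_std_normal_prod:
      "(\<integral>z. (\<Prod>b\<in>Basis. std_normal_density (z \<bullet> b)) * h (z \<bullet> b0) \<partial>lborel)
        = (\<integral>t. std_normal_density t * h t \<partial>lborel)"
proof -
  define g where "g b t = std_normal_density t * (if b = b0 then h t else 1)" for b t
  have prod_g: "(\<lambda>z::'a. (\<Prod>b\<in>Basis. std_normal_density (z \<bullet> b)) * h (z \<bullet> b0)) = (\<lambda>z. \<Prod>b\<in>Basis. g b (z \<bullet> b))"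
    using b0 by (simp add: g_def prod.distrib prod.delta)
  have g: "integrable lborel (g b)" for b
    using h integrable_std_normal_moment[of 0] by (cases "b = b0") (simp_all add: g_def[abs_def])
  then show "integrable lborel (\<lambda>z::'a. (\<Prod>b\<in>Basis. std_normal_density (z \<bullet> b)) * h (z \<bullet> b0))"
    unfolding prod_g by (rule integrable_lborel_prod_Basis)
  have "(\<integral>t. std_normal_density t \<partial>lborel) = 1"
    using integral_std_normal_moment_even[of 0] by simp
  then have "(\<integral>t. g b t \<partial>lborel) = (if b = b0 then \<integral>t. std_normal_density t * h t \<partial>lborel else 1)" for b
    by (simp add: g_def)
  then show "(\<integral>z. (\<Prod>b\<in>Basis. std_normal_density (z \<bullet> b)) * h (z \<bullet> b0) \<partial>lborel)
      = (\<integral>t. std_normal_density t * h t \<partial>lborel)"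
    unfolding prod_g using b0 g by (simp add: integral_lborel_prod_Basis prod.delta)
qed

lemma gauss_density_nonneg: "pos_def A \<Longrightarrow> 0 \<le> gauss_density A x"
  by (simp add: gauss_density_def pos_def_det_pos less_imp_le)

lemma gauss_density_borel_measurable [measurable]: "gauss_density A \<in> borel_measurable borel"
proof -
  have "continuous_on UNIV (\<lambda>x. exp (- (x \<bullet> (matrix_inv A *v x)) / 2))"
    by (intro continuous_intros linear_continuous_on matrix_vector_mul_bounded_linear) auto
  then have [measurable]: "(\<lambda>x. exp (- (x \<bullet> (matrix_inv A *v x)) / 2)) \<in> borel_measurable borel"
    by (rule borel_measurable_continuous_onI)
  show ?thesis
    unfolding gauss_density_def[abs_def] by measurable
qed

theorem
  fixes A :: "real^'n^'n" and c :: "real^'n" and h :: "real \<Rightarrow> real"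
  defines "\<sigma> \<equiv> sqrt (c \<bullet> (A *v c))"
  assumes A: "pos_def A" and [measurable]: "h \<in> borel_measurable borel"
    and h: "integrable lborel (\<lambda>t. std_normal_density t * h (\<sigma> * t))"
  shows integrable_gaussian_linear_form: "integrable (gaussian A) (\<lambda>x. h (c \<bullet> x))"
    and integral_gaussian_linear_form:
      "(\<integral>x. h (c \<bullet> x) \<partial>gaussian A) = (\<integral>t. std_normal_density t * h (\<sigma> * t) \<partial>lborel)"
proof -
  \<comment> \<open>any coordinate axis can carry the direction \<open>c\<close>\<close>
  fix i0 :: 'n
  obtain C :: "real^'n^'n" where C: "invertible C" "C ** transpose C = A"
    and Cc: "transpose C *v c = \<sigma> *\<^sub>R axis i0 1"
    using gaussian_standardization[OF A, of c i0] unfolding \<sigma>_def by blast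
  define f where "f x = gauss_density A x * h (c \<bullet> x)" for x
  have [measurable]: "f \<in> borel_measurable borel"
    unfolding f_def by measurable
  have "det C \<noteq> 0"
    using C(1) by (simp add: invertible_det_nz)
  have fC: "\<bar>det C\<bar> *\<^sub>R f (C *v z) = (\<Prod>b\<in>Basis. std_normal_density (z \<bullet> b)) * h (\<sigma> * (z \<bullet> axis i0 1))" for z
  proof -
    have "c \<bullet> (C *v z) = \<sigma> * (z \<bullet> axis i0 1)"
      by (simp add: inner_matrix_vector_mult_transpose Cc inner_commute del: transpose_matrix_vector)
    then have "\<bar>det C\<bar> *\<^sub>R f (C *v z) = (gauss_density (C ** transpose C) (C *v z) * \<bar>det C\<bar>) * h (\<sigma> * (z \<bullet> axis i0 1))"
      by (simp add: f_def C(2))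
    then show ?thesis
      by (simp add: gauss_density_standardize[OF C(1)] prod_Basis_cart)
  qed
  have "axis i0 1 \<in> (Basis :: (real^'n) set)"
    by (simp add: Basis_vec_axis)
  note std_normal_prod = integrable_lborel_std_normal_prod[OF this, of "\<lambda>t. h (\<sigma> * t)", OF h]
    integral_lborel_std_normal_prod[OF this, of "\<lambda>t. h (\<sigma> * t)", OF h]
  have "integrable lborel (\<lambda>z. \<bar>det C\<bar> *\<^sub>R f (C *v z))"
    unfolding fC using std_normal_prod(1) by simp
  then have "integrable lborel f"
    using \<open>det C \<noteq> 0\<close> integrable_lborel_matrix_vector_mult_iff[OF C(1), of f] by simp
  then show "integrable (gaussian A) (\<lambda>x. h (c \<bullet> x))"
    unfolding gaussian_def f_def by (subst integrable_density) (auto simp: gauss_density_nonneg[OF A])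
  have "(\<integral>x. h (c \<bullet> x) \<partial>gaussian A) = (\<integral>x. f x \<partial>lborel)"
    unfolding gaussian_def f_def by (subst integral_density) (auto simp: gauss_density_nonneg[OF A])
  also have "\<dots> = (\<integral>z. \<bar>det C\<bar> *\<^sub>R f (C *v z) \<partial>lborel)"
    using \<open>det C \<noteq> 0\<close> by (simp add: integral_lborel_matrix_vector_mult[OF C(1)])
  also have "\<dots> = (\<integral>t. std_normal_density t * h (\<sigma> * t) \<partial>lborel)"
    unfolding fC using std_normal_prod(2) by simp
  finally show "(\<integral>x. h (c \<bullet> x) \<partial>gaussian A) = (\<integral>t. std_normal_density t * h (\<sigma> * t) \<partial>lborel)" .
qed

lemma pos_def_inner_commute: "pos_def A \<Longrightarrow> b \<bullet> (A *v a) = a \<bullet> (A *v b)"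
  for A :: "real^'n^'n"
  by (metis pos_def_def inner_commute inner_matrix_vector_mult_transpose)

lemma pos_def_nonneg: "pos_def A \<Longrightarrow> 0 \<le> c \<bullet> (A *v c)"
  for A :: "real^'n^'n"
  unfolding pos_def_def by (cases "c = 0") (auto intro: less_imp_le)

lemma integrable_vec_iff:
  fixes f :: "'a \<Rightarrow> 'b::euclidean_space^'n"
  shows "integrable M f \<longleftrightarrow> (\<forall>i. integrable M (\<lambda>x. f x $ i))"
proof safe
  fix i
  assume "integrable M f"
  then show "integrable M (\<lambda>x. f x $ i)"
    by (rule integrable_bounded_linear[OF bounded_linear_vec_nth])
next
  assume components: "\<forall>i. integrable M (\<lambda>x. f x $ i)"
  have "integrable M (\<lambda>x. \<Sum>b\<in>Basis. (f x \<bullet> b) *\<^sub>R b)"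
  proof (intro Bochner_Integration.integrable_sum integrable_scaleR_left)
    fix b :: "'b^'n"
    assume "b \<in> Basis"
    then obtain i c where "b = axis i c" "c \<in> Basis"
      by (auto simp: Basis_vec_def)
    then show "integrable M (\<lambda>x. f x \<bullet> b)"
      using components by (simp add: inner_axis)
  qed
  then show "integrable M f"
    by (simp add: euclidean_representation)
qed

lemma integral_vec_nth:
  fixes f :: "'a \<Rightarrow> 'b::euclidean_space^'n"
  assumes "integrable M f"
  shows "(\<integral>x. f x \<partial>M) $ i = (\<integral>x. f x $ i \<partial>M)"
  using integral_bounded_linear[OF bounded_linear_vec_nth assms] by simp

lemma linear_outer_left: "linear (\<lambda>a. outer a b)"
  by (simp add: linear_iff vec_eq_iff outer_def algebra_simps)

lemma linear_outer_right: "linear (\<lambda>b. outer a b)"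
  by (simp add: linear_iff vec_eq_iff outer_def algebra_simps)

lemma bounded_linear_outer_left: "bounded_linear (\<lambda>a. outer a b)"
  using linear_outer_left by (simp add: linear_conv_bounded_linear)

lemma bounded_linear_outer_right: "bounded_linear (\<lambda>b. outer a b)"
  using linear_outer_right by (simp add: linear_conv_bounded_linear)

lemmas outer_bilinear =
  linear_add[OF linear_outer_left] linear_add[OF linear_outer_right]
  linear_diff[OF linear_outer_left] linear_diff[OF linear_outer_right]
  linear_scale[OF linear_outer_left] linear_scale[OF linear_outer_right]
  linear_neg[OF linear_outer_left] linear_neg[OF linear_outer_right]

lemma outer_axis_entry: "outer x x $ i $ j = (axis i 1 \<bullet> x) * (axis j 1 \<bullet> x)"
  by (simp add: outer_def inner_axis')

lemmas bilinear_expansions = inner_add_left inner_add_right inner_diff_left inner_diff_right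
  matrix_vector_right_distrib matrix_vector_mult_diff_distrib

context
  fixes A :: "real^'n^'n"
  assumes A: "pos_def A"
begin

lemma
  shows integrable_gaussian_power: "integrable (gaussian A) (\<lambda>x. (c \<bullet> x) ^ k)"
    and integral_gaussian_power:
      "(\<integral>x. (c \<bullet> x) ^ k \<partial>gaussian A) = sqrt (c \<bullet> (A *v c)) ^ k * (\<integral>t. std_normal_density t * t ^ k \<partial>lborel)"
proof -
  define \<sigma> where "\<sigma> = sqrt (c \<bullet> (A *v c))"
  have scale: "std_normal_density t * (\<sigma> * t) ^ k = \<sigma> ^ k * (std_normal_density t * t ^ k)" for t
    by (simp add: power_mult_distrib)
  have "integrable lborel (\<lambda>t. std_normal_density t * (\<sigma> * t) ^ k)"
    unfolding scale using integrable_std_normal_moment[of k] by simp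
  note linear_form = integrable_gaussian_linear_form[where h="\<lambda>t. t ^ k" and c=c and A=A, folded \<sigma>_def, OF A _ this]
    integral_gaussian_linear_form[where h="\<lambda>t. t ^ k" and c=c and A=A, folded \<sigma>_def, OF A _ this]
  show "integrable (gaussian A) (\<lambda>x. (c \<bullet> x) ^ k)"
    using linear_form(1) by simp
  show "(\<integral>x. (c \<bullet> x) ^ k \<partial>gaussian A) = sqrt (c \<bullet> (A *v c)) ^ k * (\<integral>t. std_normal_density t * t ^ k \<partial>lborel)"
    using linear_form(2) unfolding scale by (simp add: \<sigma>_def)
qed

lemma prob_space_gaussian: "prob_space (gaussian A)"
proof
  have "integrable (gaussian A) (\<lambda>_. 1::real)" "(\<integral>_. 1 \<partial>gaussian A) = (1::real)"
    using integrable_gaussian_power[of 0 0] integral_gaussian_power[of 0 0] integral_std_normal_moment_even[of 0]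
    by simp_all
  then show "emeasure (gaussian A) (space (gaussian A)) = 1"
    by (simp add: integrable_iff_bounded emeasure_eq_ennreal_measure less_top[symmetric])
qed

lemma integral_gaussian_square: "(\<integral>x. (c \<bullet> x)\<^sup>2 \<partial>gaussian A) = c \<bullet> (A *v c)"
  using integral_gaussian_power[of c 2] integral_std_normal_moment_even[of 1] pos_def_nonneg[OF A, of c]
  by simp

lemma integral_gaussian_fourth_power: "(\<integral>x. (c \<bullet> x) ^ 4 \<partial>gaussian A) = 3 * (c \<bullet> (A *v c))\<^sup>2"
proof -
  have "sqrt (c \<bullet> (A *v c)) ^ 4 = (c \<bullet> (A *v c))\<^sup>2"
  proof -
    have "sqrt (c \<bullet> (A *v c)) ^ 4 = (sqrt (c \<bullet> (A *v c)) ^ 2) ^ 2"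
      by (simp flip: power_mult)
    then show ?thesis
      using pos_def_nonneg[OF A, of c] by simp
  qed
  then show ?thesis
    using integral_gaussian_power[of c 4] integral_std_normal_moment_even[of 2] by (simp add: fact_numeral)
qed

lemma
  shows integrable_gaussian_inner_mult: "integrable (gaussian A) (\<lambda>x. (a \<bullet> x) * (b \<bullet> x))"
    and integral_gaussian_inner_mult: "(\<integral>x. (a \<bullet> x) * (b \<bullet> x) \<partial>gaussian A) = a \<bullet> (A *v b)"
proof -
  have polar: "(a \<bullet> x) * (b \<bullet> x) = ((a + b) \<bullet> x)\<^sup>2 / 4 - ((a - b) \<bullet> x)\<^sup>2 / 4" for x
    by (simp add: inner_add_left inner_diff_left power2_eq_square field_simps)
  show "integrable (gaussian A) (\<lambda>x. (a \<bullet> x) * (b \<bullet> x))"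
    unfolding polar by (intro Bochner_Integration.integrable_diff integrable_divide integrable_gaussian_power)
  have "(\<integral>x. (a \<bullet> x) * (b \<bullet> x) \<partial>gaussian A) = ((a + b) \<bullet> (A *v (a + b))) / 4 - ((a - b) \<bullet> (A *v (a - b))) / 4"
    unfolding polar by (simp add: integral_gaussian_square integrable_gaussian_power)
  also have "\<dots> = a \<bullet> (A *v b)"
    using pos_def_inner_commute[OF A, of b a] by (simp add: bilinear_expansions field_simps)
  finally show "(\<integral>x. (a \<bullet> x) * (b \<bullet> x) \<partial>gaussian A) = a \<bullet> (A *v b)" .
qed

lemma
  shows integrable_gaussian_square_mult_square: "integrable (gaussian A) (\<lambda>x. (a \<bullet> x)\<^sup>2 * (e \<bullet> x)\<^sup>2)"
    and integral_gaussian_square_mult_square: "(\<integral>x. (a \<bullet> x)\<^sup>2 * (e \<bullet> x)\<^sup>2 \<partial>gaussian A)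
      = (a \<bullet> (A *v a)) * (e \<bullet> (A *v e)) + 2 * (a \<bullet> (A *v e))\<^sup>2"
proof -
  have polar: "(a \<bullet> x)\<^sup>2 * (e \<bullet> x)\<^sup>2 = ((a + e) \<bullet> x) ^ 4 / 12 + ((a - e) \<bullet> x) ^ 4 / 12
      - (a \<bullet> x) ^ 4 / 6 - (e \<bullet> x) ^ 4 / 6" for x
    by (simp add: inner_add_left inner_diff_left power2_eq_square power4_eq_xxxx field_simps)
  show "integrable (gaussian A) (\<lambda>x. (a \<bullet> x)\<^sup>2 * (e \<bullet> x)\<^sup>2)"
    unfolding polar by (intro Bochner_Integration.integrable_diff Bochner_Integration.integrable_add
        integrable_divide integrable_gaussian_power)
  have "(\<integral>x. (a \<bullet> x)\<^sup>2 * (e \<bullet> x)\<^sup>2 \<partial>gaussian A)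
      = ((a + e) \<bullet> (A *v (a + e)))\<^sup>2 / 4 + ((a - e) \<bullet> (A *v (a - e)))\<^sup>2 / 4
        - (a \<bullet> (A *v a))\<^sup>2 / 2 - (e \<bullet> (A *v e))\<^sup>2 / 2"
    unfolding polar by (simp add: integral_gaussian_fourth_power integrable_gaussian_power)
  also have "\<dots> = (a \<bullet> (A *v a)) * (e \<bullet> (A *v e)) + 2 * (a \<bullet> (A *v e))\<^sup>2"
    using pos_def_inner_commute[OF A, of e a] by (simp add: bilinear_expansions power2_eq_square field_simps)
  finally show "(\<integral>x. (a \<bullet> x)\<^sup>2 * (e \<bullet> x)\<^sup>2 \<partial>gaussian A) = (a \<bullet> (A *v a)) * (e \<bullet> (A *v e)) + 2 * (a \<bullet> (A *v e))\<^sup>2" .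
qed

lemma
  shows integrable_gaussian_square_mult: "integrable (gaussian A) (\<lambda>x. (a \<bullet> x)\<^sup>2 * ((b \<bullet> x) * (d \<bullet> x)))"
    and integral_gaussian_square_mult: "(\<integral>x. (a \<bullet> x)\<^sup>2 * ((b \<bullet> x) * (d \<bullet> x)) \<partial>gaussian A)
      = (a \<bullet> (A *v a)) * (b \<bullet> (A *v d)) + 2 * (a \<bullet> (A *v b)) * (a \<bullet> (A *v d))"
proof -
  have polar: "(a \<bullet> x)\<^sup>2 * ((b \<bullet> x) * (d \<bullet> x))
      = (a \<bullet> x)\<^sup>2 * ((b + d) \<bullet> x)\<^sup>2 / 4 - (a \<bullet> x)\<^sup>2 * ((b - d) \<bullet> x)\<^sup>2 / 4" for x
    by (simp add: inner_add_left inner_diff_left power2_eq_square field_simps)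
  show "integrable (gaussian A) (\<lambda>x. (a \<bullet> x)\<^sup>2 * ((b \<bullet> x) * (d \<bullet> x)))"
    unfolding polar by (intro Bochner_Integration.integrable_diff integrable_divide
        integrable_gaussian_square_mult_square)
  have "(\<integral>x. (a \<bullet> x)\<^sup>2 * ((b \<bullet> x) * (d \<bullet> x)) \<partial>gaussian A)
      = ((a \<bullet> (A *v a)) * ((b + d) \<bullet> (A *v (b + d))) + 2 * (a \<bullet> (A *v (b + d)))\<^sup>2) / 4
        - ((a \<bullet> (A *v a)) * ((b - d) \<bullet> (A *v (b - d))) + 2 * (a \<bullet> (A *v (b - d)))\<^sup>2) / 4"
    unfolding polar by (simp add: integral_gaussian_square_mult_square integrable_gaussian_square_mult_square)
  also have "\<dots> = (a \<bullet> (A *v a)) * (b \<bullet> (A *v d)) + 2 * (a \<bullet> (A *v b)) * (a \<bullet> (A *v d))"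
    using pos_def_inner_commute[OF A, of d b] by (simp add: bilinear_expansions power2_eq_square field_simps)
  finally show "(\<integral>x. (a \<bullet> x)\<^sup>2 * ((b \<bullet> x) * (d \<bullet> x)) \<partial>gaussian A)
      = (a \<bullet> (A *v a)) * (b \<bullet> (A *v d)) + 2 * (a \<bullet> (A *v b)) * (a \<bullet> (A *v d))" .
qed

lemma inner_matrix_vector_mult_axis: "v \<bullet> (A *v axis i 1) = (A *v v) $ i"
  using pos_def_inner_commute[OF A, of v "axis i 1"] by (simp add: inner_axis')

lemma
  shows integrable_gaussian_inner_scaleR: "integrable (gaussian A) (\<lambda>x. (v \<bullet> x) *\<^sub>R x)"
    and integral_gaussian_inner_scaleR: "(\<integral>x. (v \<bullet> x) *\<^sub>R x \<partial>gaussian A) = A *v v"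
proof -
  have entry: "((v \<bullet> x) *\<^sub>R x) $ i = (v \<bullet> x) * (axis i 1 \<bullet> x)" for x i
    by (simp add: inner_axis')
  show integrable: "integrable (gaussian A) (\<lambda>x. (v \<bullet> x) *\<^sub>R x)"
    unfolding integrable_vec_iff entry by (simp add: integrable_gaussian_inner_mult)
  have "(\<integral>x. (v \<bullet> x) *\<^sub>R x \<partial>gaussian A) $ i = (A *v v) $ i" for i
  proof -
    have "(\<integral>x. (v \<bullet> x) *\<^sub>R x \<partial>gaussian A) $ i = (\<integral>x. (v \<bullet> x) * (axis i 1 \<bullet> x) \<partial>gaussian A)"
      unfolding integral_vec_nth[OF integrable] entry ..
    also have "\<dots> = (A *v v) $ i"
      by (simp add: integral_gaussian_inner_mult inner_matrix_vector_mult_axis)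
    finally show ?thesis .
  qed
  then show "(\<integral>x. (v \<bullet> x) *\<^sub>R x \<partial>gaussian A) = A *v v"
    by (simp add: vec_eq_iff)
qed

lemma
  shows integrable_gaussian_square_scaleR_outer: "integrable (gaussian A) (\<lambda>x. (v \<bullet> x)\<^sup>2 *\<^sub>R outer x x)"
    and integral_gaussian_square_scaleR_outer:
      "(\<integral>x. (v \<bullet> x)\<^sup>2 *\<^sub>R outer x x \<partial>gaussian A) = (v \<bullet> (A *v v)) *\<^sub>R A + 2 *\<^sub>R outer (A *v v) (A *v v)"
proof -
  have entry: "((v \<bullet> x)\<^sup>2 *\<^sub>R outer x x) $ i $ j = (v \<bullet> x)\<^sup>2 * ((axis i 1 \<bullet> x) * (axis j 1 \<bullet> x))" for x i j
    by (simp add: outer_axis_entry)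
  have integrable_row: "integrable (gaussian A) (\<lambda>x. ((v \<bullet> x)\<^sup>2 *\<^sub>R outer x x) $ i)" for i
    unfolding integrable_vec_iff entry by (simp add: integrable_gaussian_square_mult)
  then show integrable: "integrable (gaussian A) (\<lambda>x. (v \<bullet> x)\<^sup>2 *\<^sub>R outer x x)"
    by (simp add: integrable_vec_iff)
  have "(\<integral>x. (v \<bullet> x)\<^sup>2 *\<^sub>R outer x x \<partial>gaussian A) $ i $ j
      = ((v \<bullet> (A *v v)) *\<^sub>R A + 2 *\<^sub>R outer (A *v v) (A *v v)) $ i $ j" for i j
  proof -
    have "(\<integral>x. (v \<bullet> x)\<^sup>2 *\<^sub>R outer x x \<partial>gaussian A) $ i $ j
        = (\<integral>x. (v \<bullet> x)\<^sup>2 * ((axis i 1 \<bullet> x) * (axis j 1 \<bullet> x)) \<partial>gaussian A)"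
      unfolding integral_vec_nth[OF integrable] integral_vec_nth[OF integrable_row] entry ..
    also have "\<dots> = ((v \<bullet> (A *v v)) *\<^sub>R A + 2 *\<^sub>R outer (A *v v) (A *v v)) $ i $ j"
      using pos_def_symmetric[OF A, of j i]
      by (simp add: integral_gaussian_square_mult inner_matrix_vector_mult_axis matrix_vector_mul_component
          inner_axis outer_def)
    finally show ?thesis .
  qed
  then show "(\<integral>x. (v \<bullet> x)\<^sup>2 *\<^sub>R outer x x \<partial>gaussian A) = (v \<bullet> (A *v v)) *\<^sub>R A + 2 *\<^sub>R outer (A *v v) (A *v v)"
    by (simp add: vec_eq_iff)
qed

end

section \<open>Second moments of a square-integrable distribution\<close>

context
  fixes M :: "(real^'n) measure"
  assumes prob: "prob_space M" and sets_M: "sets M = sets borel"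
    and square_integrable: "integrable M (\<lambda>w. norm w ^ 2)"
begin

interpretation prob_space M
  by (rule prob)

lemma borel_measurable_M_eq: "borel_measurable M = borel_measurable borel"
  by (rule measurable_cong_sets[OF sets_M refl])

lemma integrable_ident: "integrable M (\<lambda>w::real^'n. w)"
proof (rule Bochner_Integration.integrable_bound[OF _ _ AE_I2])
  show "integrable M (\<lambda>w::real^'n. 1 + norm w ^ 2)"
    using square_integrable by simp
  show "(\<lambda>w::real^'n. w) \<in> borel_measurable M"
    by (simp add: borel_measurable_M_eq)
  fix w :: "real^'n"
  have "norm w \<le> 1 + norm w ^ 2"
  proof (cases "norm w \<le> 1")
    case False
    then have "norm w \<le> norm w ^ 2"
      by (simp add: power2_eq_square mult_le_cancel_left1)
    then show ?thesis
      by simp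
  qed (simp add: add_increasing2)
  then show "norm w \<le> norm (1 + norm w ^ 2)"
    by simp
qed

lemma integrable_outer_self: "integrable M (\<lambda>w::real^'n. outer w w)"
  unfolding integrable_vec_iff
proof (intro allI Bochner_Integration.integrable_bound[OF square_integrable _ AE_I2])
  fix i j
  show "(\<lambda>w::real^'n. outer w w $ i $ j) \<in> borel_measurable M"
    unfolding borel_measurable_M_eq outer_def by (intro borel_measurable_continuous_onI continuous_intros)
  fix w :: "real^'n"
  have "\<bar>w $ i\<bar> * \<bar>w $ j\<bar> \<le> norm w * norm w"
    by (intro mult_mono component_le_norm_cart) auto
  then show "norm (outer w w $ i $ j) \<le> norm (norm w ^ 2)"
    by (simp add: outer_def abs_mult power2_eq_square)
qed

lemma
  fixes a :: "real^'n"
  shows integrable_outer_diff: "integrable M (\<lambda>w. outer (w - a) (w - a))"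
    and integral_outer_diff: "(\<integral>w. outer (w - a) (w - a) \<partial>M)
      = (\<integral>w. outer w w \<partial>M) - outer (\<integral>w. w \<partial>M) a - outer a (\<integral>w. w \<partial>M) + outer a a"
proof -
  have expand: "outer (w - a) (w - a) = outer w w - outer w a - outer a w + outer a a" for w
    by (simp add: outer_bilinear)
  note integrable = integrable_outer_self integrable_ident[THEN integrable_bounded_linear[OF bounded_linear_outer_left]]
    integrable_ident[THEN integrable_bounded_linear[OF bounded_linear_outer_right]]
  show "integrable M (\<lambda>w. outer (w - a) (w - a))"
    unfolding expand using integrable by simp
  show "(\<integral>w. outer (w - a) (w - a) \<partial>M)
      = (\<integral>w. outer w w \<partial>M) - outer (\<integral>w. w \<partial>M) a - outer a (\<integral>w. w \<partial>M) + outer a a"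
    unfolding expand using integrable
    by (simp add: integral_bounded_linear[OF bounded_linear_outer_left integrable_ident]
        integral_bounded_linear[OF bounded_linear_outer_right integrable_ident] prob_space)
qed

corollary integral_outer_diff_mean:
  fixes a :: "real^'n"
  defines "m \<equiv> (\<integral>w. w \<partial>M)"
  shows "(\<integral>w. outer (w - a) (w - a) \<partial>M) = (\<integral>w. outer (w - m) (w - m) \<partial>M) + outer (m - a) (m - a)"
  unfolding m_def integral_outer_diff by (simp add: outer_bilinear)

end

section \<open>The SGD noise covariance\<close>

lemma matrix_mult_scaleR_left: "(c *\<^sub>R A) ** B = c *\<^sub>R (A ** B)"
  and matrix_mult_scaleR_right: "A ** (c *\<^sub>R B) = c *\<^sub>R (A ** B)"
  for A B :: "real^'n^'n"
  by (simp_all add: vec_eq_iff matrix_matrix_mult_def sum_distrib_left algebra_simps)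

lemma trace_scaleR: "trace (c *\<^sub>R A) = c * trace A"
  for A :: "real^'n^'n"
  by (simp add: trace_def sum_distrib_left)

lemma trace_mult_outer: "trace (M ** outer a a) = a \<bullet> (M *v a)"
  for M :: "real^'n^'n"
  by (simp add: trace_def matrix_matrix_mult_def outer_def inner_vec_def matrix_vector_mult_def
      sum_distrib_left mult.commute mult.left_commute)

lemma mult_outer_mult: "M ** outer a b ** N = outer (M *v a) (transpose N *v b)"
  for M N :: "real^'n^'n"
  by (simp add: vec_eq_iff matrix_matrix_mult_def outer_def matrix_vector_mult_def transpose_def
      sum_distrib_left sum_distrib_right algebra_simps)

definition noise_cov_map :: "real^'n^'n \<Rightarrow> nat \<Rightarrow> real^'n^'n \<Rightarrow> real^'n^'n" where
  "noise_cov_map A S V = (1 / real S) *\<^sub>R (trace (A ** V) *\<^sub>R A + A ** V ** A)"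

lemma bounded_linear_noise_cov_map: "bounded_linear (noise_cov_map A S)"
  unfolding linear_conv_bounded_linear[symmetric]
  by (simp add: linear_iff noise_cov_map_def trace_add trace_scaleR matrix_add_ldistrib matrix_add_rdistrib
      matrix_mult_scaleR_left matrix_mult_scaleR_right scaleR_add_right add_divide_distrib scaleR_add_left)

theorem noise_cov_gaussian:
  fixes A \<Gamma> :: "real^'n^'n" and u w :: "real^'n"
  assumes A: "pos_def A"
  shows "noise_cov A \<Gamma> u S w = noise_cov_map A S (outer (w - u) (w - u))"
proof -
  interpret prob_space "gaussian A"
    by (rule prob_space_gaussian[OF A])
  define v where "v = w - u"
  define \<gamma> where "\<gamma> = \<Gamma> *v w"
  have grad: "sample_grad \<Gamma> u x w = (v \<bullet> x) *\<^sub>R x + \<gamma>" for x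
    by (simp add: sample_grad_def v_def \<gamma>_def)
  note first = integrable_gaussian_inner_scaleR[OF A, of v] integral_gaussian_inner_scaleR[OF A, of v]
  note second = integrable_gaussian_square_scaleR_outer[OF A, of v] integral_gaussian_square_scaleR_outer[OF A, of v]
  have full: "full_grad A \<Gamma> u w = A *v v + \<gamma>"
    unfolding full_grad_def grad using first by (simp add: prob_space)
  have "outer (sample_grad \<Gamma> u x w) (sample_grad \<Gamma> u x w)
      = (v \<bullet> x)\<^sup>2 *\<^sub>R outer x x + (outer ((v \<bullet> x) *\<^sub>R x) \<gamma> + outer \<gamma> ((v \<bullet> x) *\<^sub>R x) + outer \<gamma> \<gamma>)" for x
    by (simp add: grad outer_bilinear power2_eq_square scaleR_add_right)
  then have "(\<integral>x. outer (sample_grad \<Gamma> u x w) (sample_grad \<Gamma> u x w) \<partial>gaussian A)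
      = (v \<bullet> (A *v v)) *\<^sub>R A + 2 *\<^sub>R outer (A *v v) (A *v v)
        + (outer (A *v v) \<gamma> + outer \<gamma> (A *v v) + outer \<gamma> \<gamma>)"
    using first second
    by (simp add: integrable_bounded_linear[OF bounded_linear_outer_left] integrable_bounded_linear[OF bounded_linear_outer_right]
        integral_bounded_linear[OF bounded_linear_outer_left] integral_bounded_linear[OF bounded_linear_outer_right]
        prob_space)
  moreover have "outer (A *v v + \<gamma>) (A *v v + \<gamma>) = outer (A *v v) (A *v v) + (outer (A *v v) \<gamma> + outer \<gamma> (A *v v) + outer \<gamma> \<gamma>)"
    by (simp add: outer_bilinear)
  ultimately show ?thesis
    unfolding noise_cov_def full v_def[symmetric]
    using A by (simp add: noise_cov_map_def trace_mult_outer mult_outer_mult scaleR_2 pos_def_def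
        flip: scaleR_diff_right del: transpose_matrix_vector)
qed

lemma matrix_inv_commute:
  fixes K X :: "real^'n^'n"
  assumes "invertible K" and "K ** X = X ** K"
  shows "matrix_inv K ** X = X ** matrix_inv K"
proof -
  have "matrix_inv K ** X = matrix_inv K ** X ** (K ** matrix_inv K)"
    using assms(1) by (simp add: matrix_inv_right)
  also have "\<dots> = matrix_inv K ** (K ** X) ** matrix_inv K"
    by (simp add: assms(2) matrix_mul_assoc)
  also have "\<dots> = X ** matrix_inv K"
    using assms(1) by (simp add: matrix_mul_assoc matrix_inv_left)
  finally show ?thesis .
qed

lemma transpose_matrix_inv_symmetric:
  fixes K :: "real^'n^'n"
  assumes "invertible K" and "transpose K = K"
  shows "transpose (matrix_inv K) = matrix_inv K"
proof -
  have "K ** transpose (matrix_inv K) = mat 1"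
    using assms by (metis matrix_inv_left matrix_transpose_mul transpose_mat)
  then have "matrix_inv K = transpose (matrix_inv K)"
    by (rule matrix_inv_unique)
  then show ?thesis
    by simp
qed

lemma ridge_identities:
  fixes A \<Gamma> :: "real^'n^'n" and u :: "real^'n"
  defines "K \<equiv> A + \<Gamma>"
  defines "A' \<equiv> matrix_inv K ** A"
  defines "\<Gamma>' \<equiv> matrix_inv K ** \<Gamma>"
  assumes A_sym: "transpose A = A" and \<Gamma>_sym: "transpose \<Gamma> = \<Gamma>"
    and comm: "A ** \<Gamma> = \<Gamma> ** A" and K_inv: "invertible K"
  shows "matrix_inv K *v (A *v u) - u = - (\<Gamma>' *v u)"
    and "trace (transpose \<Gamma>' ** A ** \<Gamma>' ** outer u u) = trace (A ** outer (\<Gamma>' *v u) (\<Gamma>' *v u))"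
    and "\<Gamma> ** A' ** outer u u ** A' ** \<Gamma> = A ** outer (\<Gamma>' *v u) (\<Gamma>' *v u) ** A"
proof -
  have "matrix_inv K *v (A *v u) + \<Gamma>' *v u = matrix_inv K *v (K *v u)"
    by (simp add: K_def \<Gamma>'_def matrix_vector_mult_add_rdistrib matrix_vector_right_distrib
        matrix_vector_mul_assoc)
  also have "\<dots> = u"
    using K_inv by (simp add: matrix_vector_mul_assoc matrix_inv_left)
  finally show "matrix_inv K *v (A *v u) - u = - (\<Gamma>' *v u)"
    by (metis add_diff_cancel_left' minus_diff_eq)
  show "trace (transpose \<Gamma>' ** A ** \<Gamma>' ** outer u u) = trace (A ** outer (\<Gamma>' *v u) (\<Gamma>' *v u))"
    by (simp add: trace_mult_outer inner_matrix_vector_mult_transpose matrix_vector_mul_assoc[symmetric]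
        del: transpose_matrix_vector)
  have KA: "matrix_inv K ** A = A ** matrix_inv K" and K\<Gamma>: "matrix_inv K ** \<Gamma> = \<Gamma> ** matrix_inv K"
    using K_inv comm by (simp_all add: matrix_inv_commute K_def matrix_add_ldistrib matrix_add_rdistrib)
  have "\<Gamma> ** A' = matrix_inv K ** (\<Gamma> ** A)"
    by (simp add: A'_def matrix_mul_assoc K\<Gamma>)
  also have "\<dots> = A ** \<Gamma>'"
    by (simp add: \<Gamma>'_def comm[symmetric] matrix_mul_assoc KA)
  finally have \<Gamma>A': "\<Gamma> ** A' = A ** \<Gamma>'" .
  have "transpose K = transpose A + transpose \<Gamma>"
    by (simp add: K_def transpose_def vec_eq_iff)
  then have "transpose K = K"
    by (simp add: K_def A_sym \<Gamma>_sym)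
  then have "transpose (A' ** \<Gamma>) = \<Gamma> ** (A ** matrix_inv K)"
    using K_inv by (simp add: A'_def matrix_transpose_mul transpose_matrix_inv_symmetric A_sym \<Gamma>_sym)
  also have "\<dots> = A ** \<Gamma>'"
    by (simp add: \<Gamma>'_def KA[symmetric] \<Gamma>A'[unfolded A'_def])
  finally have A'\<Gamma>: "transpose (A' ** \<Gamma>) = A ** \<Gamma>'" .
  have "\<Gamma> ** A' ** outer u u ** A' ** \<Gamma> = (\<Gamma> ** A') ** outer u u ** (A' ** \<Gamma>)"
    by (simp add: matrix_mul_assoc)
  then show "\<Gamma> ** A' ** outer u u ** A' ** \<Gamma> = A ** outer (\<Gamma>' *v u) (\<Gamma>' *v u) ** A"
    by (simp add: mult_outer_mult \<Gamma>A' A'\<Gamma> A_sym matrix_vector_mul_assoc)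
qed

theorem proposition3:
  fixes A \<Gamma> :: "real^'n^'n" and u w_star :: "real^'n" and S :: nat
    and P :: "(real^'n) measure"
  defines "K \<equiv> A + \<Gamma>"
  defines "A' \<equiv> matrix_inv K ** A"
  defines "\<Gamma>' \<equiv> matrix_inv K ** \<Gamma>"
  defines "U \<equiv> outer u u"
  defines "\<Sigma> \<equiv> integral\<^sup>L P (\<lambda>w. outer (w - w_star) (w - w_star))"
  assumes A_pd: "pos_def A"
    and \<Gamma>_sym: "transpose \<Gamma> = \<Gamma>"
    and comm: "A ** \<Gamma> = \<Gamma> ** A"
    and K_inv: "invertible K"
    and S_pos: "S \<ge> 1"
    and w_star_def: "w_star = matrix_inv K *v (A *v u)"
    and P_prob: "prob_space P"
    and P_borel: "sets P = sets borel"
    and P_sq: "integrable P (\<lambda>w. norm w ^ 2)"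
    and P_mean: "integral\<^sup>L P (\<lambda>w. w) = w_star"
  shows "integral\<^sup>L P (\<lambda>w. noise_cov A \<Gamma> u S w)
       = (1 / real S) *\<^sub>R (A ** \<Sigma> ** A + trace (A ** \<Sigma>) *\<^sub>R A
            + trace (transpose \<Gamma>' ** A ** \<Gamma>' ** U) *\<^sub>R A + \<Gamma> ** A' ** U ** A' ** \<Gamma>)"
proof -
  have A_sym: "transpose A = A"
    using A_pd by (simp add: pos_def_def)
  note ridge = ridge_identities[of A \<Gamma>, folded K_def, folded A'_def \<Gamma>'_def, OF A_sym \<Gamma>_sym comm K_inv]
  have "(\<integral>w. noise_cov A \<Gamma> u S w \<partial>P) = noise_cov_map A S (\<integral>w. outer (w - u) (w - u) \<partial>P)"
    unfolding noise_cov_gaussian[OF A_pd]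
    by (rule integral_bounded_linear[OF bounded_linear_noise_cov_map integrable_outer_diff[OF P_prob P_borel P_sq]])
  also have "(\<integral>w. outer (w - u) (w - u) \<partial>P) = \<Sigma> + outer (\<Gamma>' *v u) (\<Gamma>' *v u)"
    using integral_outer_diff_mean[OF P_prob P_borel P_sq, of u] ridge(1)
    by (simp add: \<Sigma>_def P_mean w_star_def outer_bilinear)
  also have "noise_cov_map A S \<dots> = (1 / real S) *\<^sub>R (A ** \<Sigma> ** A + trace (A ** \<Sigma>) *\<^sub>R A
      + trace (transpose \<Gamma>' ** A ** \<Gamma>' ** U) *\<^sub>R A + \<Gamma> ** A' ** U ** A' ** \<Gamma>)"
    by (simp add: noise_cov_map_def U_def ridge(2,3) trace_add matrix_add_ldistrib matrix_add_rdistrib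
        algebra_simps)
  finally show ?thesis .
qed

end
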